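(* Let $f:\mathbb{R}^n\to\mathbb{R}$ be $L$-smooth with optimal value $f^\ast$, and let $(x_k)$ be generated by the algorithm SSDPM described in the context, with step size $\alpha$, subspace rank $d$, alignment threshold $\delta$ and initial alignment $\gamma_0$. Put $\tilde\delta=\delta+\sqrt{\frac{d}{n-1}}$. Suppose that $\gamma_0>\tilde\delta$ and that, whenever the alignment vector is refreshed (at an iterate $x_k$, say), the newly generated vector $v_k$ satisfies $$\mathbb{E}\left[\langle \hat v_k,\nabla f(x_k)\rangle^2\mid x_k\right]\ \ge\ \gamma_0\,\|\nabla f(x_k)\|^2 .$$ Let $t_0=\left(\frac{\alpha L}{2}+1+\sqrt{1-\frac{d}{n-1}}\right)^{-1}$ (so $t_0\in(4/9,\,1/2+O(d/n))$), $$\tilde t_0=t_0\left(1-\frac{d}{n-1}\right)\sqrt{\frac{d}{n-1}}\left(1-\frac{4\alpha L(1-\alpha L)}{(1-2\alpha L)\log(\gamma_0/\tilde\delta)}\right),$$ and suppose the step size satisfies $$\frac1L\cdot\frac{K}{2+K+\sqrt{4+K^2}}<\alpha<\frac{1}{2L},\qquad K=\log\left(\frac{\gamma_0}{\tilde\delta}\right)\cdot\frac{t_0\left(1-\frac{d}{n-1}\right)\sqrt{\frac{d}{n-1}}-\frac{d}{n-1}}{\left(1-\frac{d}{n-1}\right)\left(\gamma_0+t_0\sqrt{\frac{d}{n-1}}\right)} .$$ Then for every $\epsilon>0$, in order to obtain $\min_{i}\mathbb{E}\left[\|\nabla f(x_i)\|^2\right]<\epsilon^2$ (minimum over the first $N$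 iterates) it suffices to run $$N\ \ge\ \frac{\alpha^{-1}\left(1-\frac{\alpha L}{2}\right)^{-1}\left(f(x_0)-f^\ast\right)}{\frac{4\alpha L(1-\alpha L)}{(1-2\alpha L)\log(\gamma_0/\tilde\delta)}\left(1-\frac{d}{n-1}\right)\gamma_0+\frac{d}{n-1}-\tilde t_0}\ \epsilon^{-2}$$ iterations.
   Context: $L$-smooth means $\|\nabla f(x)-\nabla f(y)\|\le L\|x-y\|$ for all $x,y\in\mathbb{R}^n$. For a nonzero vector $v$, $\hat v=v/\|v\|$. Algorithm SSDPM (stochastic subspace descent with persistence of memory). Inputs: step size $\alpha>0$, integer $d$ (with $d\ll n$), alignment threshold $\delta$, initial alignment $\gamma_0$. Set $\tilde\delta=\delta+\sqrt{d/(n-1)}$ and the refresh period $r=\frac{1-2\alpha L}{4\alpha L(1-\alpha L)}\log(\gamma_0/\tilde\delta)$ (treated as a positive integer). Start from an arbitrary $x_0$. For $k=1,2,\dots$: if $k-1$ is a multiple of $r$, generate a new alignment vector $v_{k-1}$ (a "refresh"); otherwise put $v_{k-1}=v_{k-2}$. Then generate, conditionally on the past and on $v_{k-1}$, a random matrix $\tilde P_{k-1}\in\mathbb{R}^{n\times d}$ with columns in $v_{k-1}^\perp$ such that $\tilde P_{k-1}^\top\tilde P_{k-1}=I_d$ and $\mathbb{E}[\tilde P_{k-1}\tilde P_{k-1}^\top]=\frac{d}{n-1}(I_n-\hat v_{k-1}\hat v_{k-1}^\top)$; put $P_{k-1}=\begin{pmatrix}\hat v_{k-1}&\tilde P_{k-1}\end{pmatrix}\in\mathbb{R}^{n\times(d+1)}$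 and $x_k=x_{k-1}-\alpha P_{k-1}P_{k-1}^\top\nabla f(x_{k-1})$. *)

theory Defs
  imports "HOL-Probability.Probability"
begin

definition grad :: "('a::real_inner \<Rightarrow> real) \<Rightarrow> 'a \<Rightarrow> 'a" where
  "grad f x = (THE g. GDERIV f x :> g)"

definition L_smooth :: "real \<Rightarrow> ('a::real_inner \<Rightarrow> real) \<Rightarrow> bool" where
  "L_smooth L f \<longleftrightarrow> (\<forall>x. f differentiable (at x)) \<and>
     (\<forall>x y. norm (grad f x - grad f y) \<le> L * norm (x - y))"

text \<open>
  The block matrix \<open>P = (v/|v|  Q)\<close>. Its \<open>d + 1\<close> columns are indexed by \<open>1 + 'd\<close>, where \<open>1\<close> is the
  one-element type; \<open>sgn v\<close> is the normalized vector \<open>v /\<^sub>R norm v\<close>.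
\<close>
definition subspace_matrix :: "real^'n \<Rightarrow> real^'d^'n \<Rightarrow> real^(1 + 'd)^'n" where
  "subspace_matrix v Q = (\<chi> i j. case j of Inl _ \<Rightarrow> sgn v $ i | Inr l \<Rightarrow> Q $ i $ l)"

text \<open>
  The information on which the choice of the matrix \<open>Q k\<close> is conditioned: the iterates
  \<open>x 0, ..., x k\<close>, the alignment vectors \<open>v 0, ..., v k\<close> and the matrices \<open>Q 0, ..., Q (k - 1)\<close>.
\<close>
definition ssdpm_history ::
    "'w measure \<Rightarrow> (nat \<Rightarrow> 'w \<Rightarrow> real^'n) \<Rightarrow> (nat \<Rightarrow> 'w \<Rightarrow> real^'n) \<Rightarrow> (nat \<Rightarrow> 'w \<Rightarrow> real^'d^'n)
      \<Rightarrow> nat \<Rightarrow> 'w measure" where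
  "ssdpm_history M x v Q k = sigma (space M)
     ((\<Union>i\<le>k. sets (vimage_algebra (space M) (x i) borel)) \<union>
      (\<Union>i\<le>k. sets (vimage_algebra (space M) (v i) borel)) \<union>
      (\<Union>i<k. sets (vimage_algebra (space M) (Q i) borel)))"

text \<open>
  Index \<open>k\<close> stands for the step leading from \<open>x k\<close> to \<open>x (Suc k)\<close>; the alignment vector is refreshed
  at \<open>x k\<close> iff \<open>r dvd k\<close>. The law of a refreshed vector is left open.
\<close>
definition ssdpm_run ::
    "'w measure \<Rightarrow> (real^'n \<Rightarrow> real) \<Rightarrow> real \<Rightarrow> nat \<Rightarrow> real^'n \<Rightarrow> (nat \<Rightarrow> 'w \<Rightarrow> real^'n)
      \<Rightarrow> (nat \<Rightarrow> 'w \<Rightarrow> real^'n) \<Rightarrow> (nat \<Rightarrow> 'w \<Rightarrow> real^'d^'n) \<Rightarrow> bool" where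
  "ssdpm_run M f \<alpha> r x0 x v Q \<longleftrightarrow>
     (\<forall>k. x k \<in> borel_measurable M \<and> v k \<in> borel_measurable M \<and> Q k \<in> borel_measurable M) \<and>
     (\<forall>\<omega>\<in>space M. x 0 \<omega> = x0) \<and>
     (\<forall>k. AE \<omega> in M. v k \<omega> \<noteq> 0) \<and>
     (\<forall>k. \<not> r dvd k \<longrightarrow> (\<forall>\<omega>\<in>space M. v k \<omega> = v (k - 1) \<omega>)) \<and>
     (\<forall>k. AE \<omega> in M. (\<forall>j. column j (Q k \<omega>) \<bullet> v k \<omega> = 0) \<and>
                      transpose (Q k \<omega>) ** Q k \<omega> = mat 1) \<and>
     (\<forall>k i j. AE \<omega> in M.
        real_cond_exp M (ssdpm_history M x v Q k)
            (\<lambda>\<omega>. (Q k \<omega> ** transpose (Q k \<omega>)) $ i $ j) \<omega>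
        = real CARD('d) / (real CARD('n) - 1) *
            ((mat 1 :: real^'n^'n) $ i $ j - sgn (v k \<omega>) $ i * sgn (v k \<omega>) $ j)) \<and>
     (\<forall>k. \<forall>\<omega>\<in>space M. x (Suc k) \<omega> = x k \<omega> -
        \<alpha> *\<^sub>R ((subspace_matrix (v k \<omega>) (Q k \<omega>) ** transpose (subspace_matrix (v k \<omega>) (Q k \<omega>)))
               *v grad f (x k \<omega>)))"

definition ssdpm_t0 :: "real \<Rightarrow> real \<Rightarrow> nat \<Rightarrow> nat \<Rightarrow> real" where
  "ssdpm_t0 \<alpha> L n d = inverse (\<alpha> * L / 2 + 1 + sqrt (1 - real d / (real n - 1)))"

end

theory Submission
  imports Defs
begin

text \<open>
  Put \<open>p = d / (n - 1)\<close> and let \<open>g\<close> be the gradient at the current iterate. As \<open>P P\<^sup>T\<close> is an orthogonal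
  projection, a step decreases \<open>f\<close> by at least \<open>\<alpha> (1 - \<alpha> L / 2) |P\<^sup>T g|\<^sup>2\<close>, and
  \<open>E |P\<^sup>T g|\<^sup>2 = p E |g|\<^sup>2 + (1 - p) E \<langle>v/|v|, g\<rangle>\<^sup>2\<close>. The last term is at least
  \<open>(1 - p) \<gamma>0 E |g|\<^sup>2\<close> at a refresh and nonnegative otherwise, and at least \<open>N / r\<close> of the first \<open>N\<close>
  steps are refreshes. If all \<open>E |g|\<^sup>2\<close> were at least \<open>\<epsilon>\<^sup>2\<close>, the total expected decrease would be at
  least \<open>\<alpha> (1 - \<alpha> L / 2) N (p + (1 - p) \<gamma>0 / r) \<epsilon>\<^sup>2\<close>. By the formula for \<open>r\<close> the denominator in the
  theorem is \<open>p + (1 - p) \<gamma>0 / r - t0t\<close> with \<open>t0t \<ge> 0\<close>, and the lower bound on \<open>\<alpha>\<close> says that it is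
  positive. Strictness comes from the last iterate: a step shrinks the gradient norm by a factor no
  smaller than \<open>1 - \<alpha> L\<close>, so \<open>E f(x\<^sub>N)\<close> stays strictly above the infimum.
\<close>

section \<open>Gradients and quadratic bounds for L-smooth functions\<close>

lemma L_smooth_GDERIV:
  fixes f :: "'a::euclidean_space \<Rightarrow> real"
  assumes "L_smooth L f"
  shows "GDERIV f x :> grad f x"
proof -
  obtain f' where f': "(f has_derivative f') (at x)"
    using assms unfolding L_smooth_def differentiable_def by blast
  then interpret f': linear f' by (rule has_derivative_linear)
  \<comment> \<open>The Riesz representative of the derivative, written in the orthonormal
    basis.\<close>
  define g where "g = (\<Sum>b\<in>Basis. f' b *\<^sub>R b)"
  have "f' h = h \<bullet> g" for h
  proof -
    have "f' h = f' (\<Sum>b\<in>Basis. (h \<bullet> b) *\<^sub>R b)"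
      by (simp add: euclidean_representation)
    also have "\<dots> = h \<bullet> g"
      by (simp add: g_def f'.sum f'.scale inner_sum_right mult.commute)
    finally show ?thesis .
  qed
  then have g: "GDERIV f x :> g"
    using f' unfolding gderiv_def by presburger
  \<comment> \<open>\<open>grad\<close> is a definite description, so it yields a gradient only once
    uniqueness is known as well.\<close>
  have uniq: "h = g" if "GDERIV f x :> h" for h
  proof -
    have "(\<lambda>y. y \<bullet> h) = (\<lambda>y. y \<bullet> g)"
      using that g has_derivative_unique unfolding gderiv_def by blast
    then show ?thesis
      by (metis inner_commute vector_eq_ldot)
  qed
  show ?thesis
    unfolding grad_def using g uniq by (rule theI)
qed

text \<open>On the ray from \<open>x\<close> in direction \<open>h\<close>, subtract from
  \<open>f\<close> its linear part and the quadratic term. By Cauchy-Schwarz and the Lipschitz bound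
  on the gradient the remainder \<open>\<psi>\<close> has nonpositive derivative for t \<ge> 0, and
  comparing t = 1 with t = 0 gives the claim.\<close>

lemma L_smooth_descent:
  fixes f :: "'a::euclidean_space \<Rightarrow> real"
  assumes "L_smooth L f"
  shows "f (x + h) \<le> f x + grad f x \<bullet> h + L / 2 * (norm h)\<^sup>2"
proof -
  define \<psi> where "\<psi> = (\<lambda>t. f (x + t *\<^sub>R h) - t * (grad f x \<bullet> h) - L / 2 * t\<^sup>2 * (norm h)\<^sup>2)"
  have "\<exists>y. DERIV \<psi> t :> y \<and> y \<le> 0" if t: "0 \<le> t" for t
  proof (intro exI conjI)
    have "((\<lambda>t. f (x + t *\<^sub>R h)) has_derivative (\<lambda>s. (s *\<^sub>R h) \<bullet> grad f (x + t *\<^sub>R h))) (at t)"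
      by (rule has_derivative_compose[where f = "\<lambda>t. x + t *\<^sub>R h" and f' = "\<lambda>s. s *\<^sub>R h"])
        (use L_smooth_GDERIV[OF assms] in \<open>auto simp: gderiv_def intro!: derivative_eq_intros\<close>)
    then have f: "DERIV (\<lambda>t. f (x + t *\<^sub>R h)) t :> h \<bullet> grad f (x + t *\<^sub>R h)"
      by (simp add: has_field_derivative_def mult_commute_abs)
    show "DERIV \<psi> t :> h \<bullet> grad f (x + t *\<^sub>R h) - grad f x \<bullet> h - L * t * (norm h)\<^sup>2"
      unfolding \<psi>_def by (rule f derivative_eq_intros refl | simp)+
    have "norm (grad f (x + t *\<^sub>R h) - grad f x) \<le> L * norm (x + t *\<^sub>R h - x)"
      using assms unfolding L_smooth_def by blast
    then have lip: "norm (grad f (x + t *\<^sub>R h) - grad f x) \<le> L * (t * norm h)"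
      using t by simp
    have "h \<bullet> (grad f (x + t *\<^sub>R h) - grad f x) \<le> norm h * norm (grad f (x + t *\<^sub>R h) - grad f x)"
      by (rule norm_cauchy_schwarz)
    also have "\<dots> \<le> norm h * (L * (t * norm h))"
      using lip by (rule mult_left_mono) simp
    also have "\<dots> = L * t * (norm h)\<^sup>2"
      by (simp add: power2_eq_square)
    finally show "h \<bullet> grad f (x + t *\<^sub>R h) - grad f x \<bullet> h - L * t * (norm h)\<^sup>2 \<le> 0"
      by (simp add: inner_diff_right inner_commute[of h "grad f x"])
  qed
  then have "\<psi> 1 \<le> \<psi> 0"
    by (rule DERIV_nonpos_imp_nonincreasing[rotated]) simp_all
  then show ?thesis
    by (simp add: \<psi>_def)
qed

text \<open>One gradient step of length 1/L decreases \<open>f\<close> by at least the left-hand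
  side, and no point lies below the infimum.\<close>

lemma L_smooth_gap:
  fixes f :: "'a::euclidean_space \<Rightarrow> real"
  assumes "0 < L" "L_smooth L f" "bdd_below (range f)"
  shows "(norm (grad f x))\<^sup>2 / (2 * L) \<le> f x - (INF y. f y)"
proof -
  have "(INF y. f y) \<le> f (x + (- (1 / L)) *\<^sub>R grad f x)"
    using assms(3) by (intro cINF_lower) auto
  also have "\<dots> \<le> f x - (norm (grad f x))\<^sup>2 / (2 * L)"
  proof -
    have "L / 2 * (norm ((- (1 / L)) *\<^sub>R grad f x))\<^sup>2 = (norm (grad f x))\<^sup>2 / (2 * L)"
      using assms(1) by (simp add: power2_eq_square)
    moreover have "grad f x \<bullet> ((- (1 / L)) *\<^sub>R grad f x) = - 2 * ((norm (grad f x))\<^sup>2 / (2 * L))"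
      by (simp add: dot_square_norm)
    ultimately show ?thesis
      using L_smooth_descent[OF assms(2), of x "(- (1 / L)) *\<^sub>R grad f x"] by linarith
  qed
  finally show ?thesis by simp
qed

lemma L_smooth_continuous_grad:
  assumes "0 \<le> L" "L_smooth L f"
  shows "continuous_on UNIV (grad f)"
proof -
  have "L-lipschitz_on UNIV (grad f)"
    using assms by (intro lipschitz_onI) (auto simp only: L_smooth_def dist_norm)
  then show ?thesis
    by (rule lipschitz_on_continuous_on)
qed

section \<open>Linear algebra of the projection P P^T\<close>

lemma subspace_matrix_projection:
  fixes Q :: "real^'d^'n"
  shows "(subspace_matrix v Q ** transpose (subspace_matrix v Q)) *v w =
     (sgn v \<bullet> w) *\<^sub>R sgn v + Q *v (transpose Q *v w)"
proof -
  \<comment> \<open>The index type \<open>1 + 'd\<close> splits into the single index of the column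
    \<open>sgn v\<close> and the indices of the columns of \<open>Q\<close>.\<close>
  have "(\<Sum>j\<in>UNIV. h j) = h (Inl 1) + (\<Sum>l\<in>UNIV. h (Inr l))"
    for h :: "1 + 'd \<Rightarrow> real"
    by (subst UNIV_Plus_UNIV[symmetric], subst sum.Plus) (auto simp: o_def)
  then show ?thesis
    unfolding matrix_vector_mul_assoc[symmetric]
    by (simp add: vec_eq_iff subspace_matrix_def transpose_def matrix_vector_mult_def inner_vec_def
        mult.commute)
qed

lemma matrix_transpose_inner:
  fixes A :: "real^'m^'n"
  shows "x \<bullet> (A *v y) = (transpose A *v x) \<bullet> y"
  by (simp add: dot_lmul_matrix flip: vector_transpose_matrix)

text \<open>The columns of P are orthonormal, so P P^T is an orthogonal projection: the squared norm
  of the image is its inner product with the argument, and it splits into a part along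
  \<open>v\<close> and a part in the range of \<open>Q\<close>. Both follow from Q^T (sgn v) = 0 and
  Q^T Q = 1.\<close>

lemma subspace_projection_inner:
  fixes Q :: "real^'d^'n"
  assumes "v \<noteq> 0" and col: "\<And>j. column j Q \<bullet> v = 0" and orth: "transpose Q ** Q = mat 1"
  defines "u \<equiv> (\<lambda>w. (subspace_matrix v Q ** transpose (subspace_matrix v Q)) *v w)"
  shows "u w \<bullet> u w = u w \<bullet> w"
    and "u w \<bullet> w = (sgn v \<bullet> w)\<^sup>2 + w \<bullet> ((Q ** transpose Q) *v w)"
proof -
  have Qv: "transpose Q *v sgn v = 0"
    using col by (simp add: vec_eq_iff matrix_vector_mult_def transpose_def column_def inner_vec_def
        sgn_vec_def sgn_div_norm mult_ac flip: sum_distrib_left)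
  have s: "sgn v \<bullet> sgn v = 1"
    using \<open>v \<noteq> 0\<close> by (simp add: norm_sgn flip: power2_norm_eq_inner)
  have QQ: "transpose Q *v (Q *v z) = z" for z
    by (simp add: matrix_vector_mul_assoc orth)
  define y where "y = transpose Q *v w"
  have u: "u w = (sgn v \<bullet> w) *\<^sub>R sgn v + Q *v y"
    by (simp only: u_def subspace_matrix_projection y_def)
  have sQ: "sgn v \<bullet> (Q *v y) = 0"
    using matrix_transpose_inner[of "sgn v" Q y] by (simp only: Qv inner_zero_left)
  have Qu: "(Q *v y) \<bullet> (Q *v y) = y \<bullet> y"
    using matrix_transpose_inner[of "Q *v y" Q y] by (simp only: QQ)
  have wQ: "w \<bullet> (Q *v y) = y \<bullet> y"
    using matrix_transpose_inner[of w Q y] by (simp only: y_def)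
  show "u w \<bullet> u w = u w \<bullet> w"
    by (simp add: u inner_add_left inner_add_right s sQ Qu wQ inner_commute[of "Q *v y" w]
        inner_commute[of "Q *v y" "sgn v"])
  have "(Q ** transpose Q) *v w = Q *v y"
    by (simp only: y_def matrix_vector_mul_assoc)
  then show "u w \<bullet> w = (sgn v \<bullet> w)\<^sup>2 + w \<bullet> ((Q ** transpose Q) *v w)"
    by (simp add: u inner_add_left power2_eq_square inner_commute[of "Q *v y" w])
qed

lemma norm_le_if_inner_self_eq:
  fixes u w :: "'a::real_inner"
  assumes "u \<bullet> u = u \<bullet> w"
  shows "norm u \<le> norm w"
proof (cases "u = 0")
  case False
  have "norm u * norm u \<le> norm u * norm w"
    using norm_cauchy_schwarz[of u w] assms by (metis dot_square_norm power2_eq_square)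
  then show ?thesis using False by simp
qed auto

text \<open>The entry is a coordinate of the projection of a unit vector, and projections do not
  increase norms. The bound makes the entries of Q Q^T integrable when multiplied by bounded
  factors.\<close>

lemma abs_orthonormal_projection_entry_le:
  fixes Q :: "real^'d^'n"
  assumes orth: "transpose Q ** Q = mat 1"
  shows "\<bar>(Q ** transpose Q) $ i $ j\<bar> \<le> 1"
proof -
  define u where "u = (Q ** transpose Q) *v axis j 1"
  have QQ: "transpose Q *v (Q *v z) = z" for z
    by (simp add: matrix_vector_mul_assoc orth)
  define y where "y = transpose Q *v axis j 1"
  have u: "u = Q *v y"
    by (simp only: u_def y_def matrix_vector_mul_assoc)
  have "u \<bullet> u = y \<bullet> y"
    using matrix_transpose_inner[of u Q y] by (simp only: u QQ)
  also have "y \<bullet> y = u \<bullet> axis j 1"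
    using matrix_transpose_inner[of "axis j 1" Q y] by (simp only: u y_def inner_commute)
  finally have "u \<bullet> u = u \<bullet> axis j 1" .
  then have "norm u \<le> 1"
    using norm_le_if_inner_self_eq[of u "axis j 1"] by simp
  then have "\<bar>u $ i\<bar> \<le> 1"
    using component_le_norm_cart[of u i] by linarith
  then show ?thesis
    by (simp add: u_def matrix_vector_mult_basis column_def)
qed

section \<open>Real inequalities for t0 and for the step size\<close>

lemma ssdpm_t0_bounds:
  assumes "0 < \<alpha>" "0 < L" "\<alpha> < 1 / (2 * L)" "0 < d" "d < n - 1"
  shows "4 / 9 < ssdpm_t0 \<alpha> L n d" and "ssdpm_t0 \<alpha> L n d < 1 / 2 + real d / real n"
proof -
  define s where "s = real d / (real n - 1)"
  define D where "D = \<alpha> * L / 2 + 1 + sqrt (1 - s)"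
  have n: "real d < real n - 1" "1 \<le> real d"
    using assms by linarith+
  have s: "0 < s" "s < 1" using n by (simp_all add: s_def)
  have a: "0 < \<alpha> * L" "\<alpha> * L < 1 / 2"
    using assms by (simp_all add: field_simps)
  \<comment> \<open>This keeps \<open>D\<close> above 2 - s; the upper bound 9/4 is 1/4 + 1 + 1,
    where 1/4 comes from \<alpha> L < 1/2.\<close>
  have "1 - s \<le> sqrt (1 - s)"
    using s by (intro real_le_rsqrt) (auto simp: power2_eq_square intro: mult_left_le)
  moreover have "sqrt (1 - s) < 1"
    using s by simp
  ultimately have D: "2 - s < D" "D < 9 / 4" "0 < D"
    using a s unfolding D_def by linarith+
  have "ssdpm_t0 \<alpha> L n d = inverse D"
    by (simp add: ssdpm_t0_def D_def s_def)
  moreover have "4 / 9 < inverse D"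
    using D by (simp add: field_simps)
  moreover have "inverse D < 1 / 2 + real d / real n"
  proof -
    have "inverse D < inverse (2 - s)"
      using D s by (intro less_imp_inverse_less) auto
    \<comment> \<open>Clearing denominators leaves s^2 \<le> s.\<close>
    also have "\<dots> \<le> 1 / 2 + s / 2"
      using s mult_left_le[of s s] by (simp add: field_simps)
    \<comment> \<open>This amounts to n \<le> 2 (n - 1), true for n \<ge> 2.\<close>
    also have "s / 2 \<le> real d / real n"
      using n by (simp add: s_def field_simps)
    finally show ?thesis by simp
  qed
  ultimately show "4 / 9 < ssdpm_t0 \<alpha> L n d" "ssdpm_t0 \<alpha> L n d < 1 / 2 + real d / real n"
    by simp_all
qed

lemma step_size_quadratic_gt:
  fixes a K :: real
  assumes "a < 1 / 2" "K / (2 + K + sqrt (4 + K\<^sup>2)) < a"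
  shows "K < 4 * a * (1 - a) / (1 - 2 * a)"
proof -
  \<comment> \<open>\<open>(2 + K - s) / 4\<close> and \<open>(2 + K + s) / 4\<close> are the roots of \<open>4 a (1 - a) = K (1 - 2 a)\<close>.\<close>
  define s where "s = sqrt (4 + K\<^sup>2)"
  have s2: "s\<^sup>2 = 4 + K\<^sup>2" by (simp add: s_def)
  have "\<bar>K\<bar> < s"
    unfolding s_def by (rule real_less_rsqrt) simp
  then have pos: "0 < K + s" by linarith
  have "(2 + K - s) / 4 = K / (2 + K + s)"
    using pos s2 by (simp add: field_simps power2_eq_square)
  then have "(2 + K - s) / 4 < a"
    using assms(2) unfolding s_def by metis
  \<comment> \<open>\<open>a\<close> exceeds the smaller root; it is below the larger one because a
    < 1/2 and K + s > 0.\<close>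
  then have "0 < (4 * a - (2 + K - s)) * ((2 + K + s) - 4 * a)"
    using pos assms(1) by (intro mult_pos_pos) auto
  also have "\<dots> = 4 * (4 * a * (1 - a) - K * (1 - 2 * a))"
    using s2 by (simp add: algebra_simps power2_eq_square)
  finally show ?thesis
    using assms(1) by (simp add: field_simps)
qed

section \<open>Measurability and conditional expectation of quadratic forms\<close>

lemma borel_measurable_vec_nth [measurable]:
  fixes W :: "'a \<Rightarrow> 'b::topological_space ^ 'n"
  assumes "W \<in> borel_measurable M"
  shows "(\<lambda>\<omega>. W \<omega> $ i) \<in> borel_measurable M"
  by (rule measurable_compose[OF assms borel_measurable_continuous_onI])
    (intro continuous_intros)

lemma borel_measurable_sgn [measurable]:
  fixes W :: "'a \<Rightarrow> 'b::{second_countable_topology, real_normed_vector}"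
  assumes [measurable]: "W \<in> borel_measurable M"
  shows "(\<lambda>\<omega>. sgn (W \<omega>)) \<in> borel_measurable M"
  unfolding sgn_div_norm by measurable

lemma quadratic_form_eq_sum:
  fixes A :: "real^'n^'n"
  shows "w \<bullet> (A *v w) = (\<Sum>i\<in>UNIV. \<Sum>j\<in>UNIV. (w $ i * w $ j) * A $ i $ j)"
  by (simp add: inner_vec_def matrix_vector_mult_def sum_distrib_left mult_ac)

lemma (in prob_space) sigma_finite_subalgebraI:
  assumes "subalgebra M F"
  shows "sigma_finite_subalgebra M F"
  using finite_measure_restr_to_subalg[OF assms finite_measure_axioms] assms
  by (simp add: sigma_finite_subalgebra_def finite_measure_def)

text \<open>The form is a finite sum of terms W_i W_j A_ij whose factors W_i W_j are
  \<open>F\<close>-measurable. These factors can be pulled out of the conditional expectation, so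
  each A_ij may be replaced by C_ij; the almost sure bounds supply integrability.\<close>

lemma (in prob_space) expectation_quadratic_form_cond_exp:
  fixes W :: "'a \<Rightarrow> real^'n" and A C :: "'a \<Rightarrow> real^'n^'n"
  assumes sub: "subalgebra M F"
    and W [measurable]: "W \<in> borel_measurable F"
    and A: "\<And>i j. (\<lambda>\<omega>. A \<omega> $ i $ j) \<in> borel_measurable M"
    and C: "\<And>i j. (\<lambda>\<omega>. C \<omega> $ i $ j) \<in> borel_measurable M"
    and A_bound: "\<And>i j. AE \<omega> in M. \<bar>A \<omega> $ i $ j\<bar> \<le> B"
    and W_bound: "AE \<omega> in M. norm (W \<omega>) \<le> b"
    and cond: "\<And>i j. AE \<omega> in M. real_cond_exp M F (\<lambda>\<omega>. A \<omega> $ i $ j) \<omega> = C \<omega> $ i $ j"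
  shows "expectation (\<lambda>\<omega>. W \<omega> \<bullet> (A \<omega> *v W \<omega>)) = expectation (\<lambda>\<omega>. W \<omega> \<bullet> (C \<omega> *v W \<omega>))"
proof -
  interpret sigma_finite_subalgebra M F
    by (rule sigma_finite_subalgebraI[OF sub])
  have WM [measurable]: "W \<in> borel_measurable M"
    by (rule measurable_from_subalg[OF sub W])
  note [measurable] = A C
  have int: "integrable M (\<lambda>\<omega>. (W \<omega> $ i * W \<omega> $ j) * A \<omega> $ i $ j)" for i j
  proof (rule integrable_const_bound[where B = "(b * b) * B"])
    show "AE \<omega> in M. norm (W \<omega> $ i * W \<omega> $ j * A \<omega> $ i $ j) \<le> b * b * B"
      using A_bound[of i j] W_bound
    proof eventually_elim
      case (elim \<omega>)
      have "\<bar>W \<omega> $ l\<bar> \<le> b" for l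
        using component_le_norm_cart[of "W \<omega>" l] elim(2) by linarith
      then have "\<bar>W \<omega> $ i\<bar> * \<bar>W \<omega> $ j\<bar> * \<bar>A \<omega> $ i $ j\<bar> \<le> (b * b) * B"
        using elim by (intro mult_mono) (auto intro: order_trans[of 0 "\<bar>W \<omega> $ i\<bar>"])
      then show ?case by (simp add: abs_mult)
    qed
  qed simp
  have AE_eq: "AE \<omega> in M. (W \<omega> $ i * W \<omega> $ j) * real_cond_exp M F (\<lambda>\<omega>. A \<omega> $ i $ j) \<omega> =
      (W \<omega> $ i * W \<omega> $ j) * C \<omega> $ i $ j" for i j
    using cond[of i j] by eventually_elim simp
  have intC: "integrable M (\<lambda>\<omega>. (W \<omega> $ i * W \<omega> $ j) * C \<omega> $ i $ j)"
    and eq: "expectation (\<lambda>\<omega>. (W \<omega> $ i * W \<omega> $ j) * A \<omega> $ i $ j) =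
      expectation (\<lambda>\<omega>. (W \<omega> $ i * W \<omega> $ j) * C \<omega> $ i $ j)" for i j
  proof -
    note ce = real_cond_exp_intg[OF int[of i j]]
    show "integrable M (\<lambda>\<omega>. (W \<omega> $ i * W \<omega> $ j) * C \<omega> $ i $ j)"
      using ce(1) integrable_cong_AE[OF _ _ AE_eq[of i j]] by simp
    show "expectation (\<lambda>\<omega>. (W \<omega> $ i * W \<omega> $ j) * A \<omega> $ i $ j) =
      expectation (\<lambda>\<omega>. (W \<omega> $ i * W \<omega> $ j) * C \<omega> $ i $ j)"
      using ce(2) integral_cong_AE[OF _ _ AE_eq[of i j]] by simp
  qed
  show ?thesis
    by (simp add: quadratic_form_eq_sum Bochner_Integration.integral_sum integrable_sum int intC eq)
qed

text \<open>The blocks of length \<open>r\<close> starting at the multiples of \<open>r\<close>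
  below \<open>N\<close> cover all indices below \<open>N\<close>; the last block may overshoot.
  Hence at least N/r of the first N steps are refreshes.\<close>

lemma card_multiples_below:
  fixes r N :: nat
  assumes "0 < r"
  shows "N \<le> r * card {k. k < N \<and> r dvd k}"
proof -
  let ?S = "{k. k < N \<and> r dvd k}"
  have "k \<in> (\<Union>m\<in>?S. {m..<m + r})" if "k < N" for k
  proof
    show "r * (k div r) \<in> ?S"
      using that by (auto intro: le_less_trans[OF times_div_less_eq_dividend])
    show "k \<in> {r * (k div r)..<r * (k div r) + r}"
      using dividend_less_times_div[OF assms, of k] by (simp add: add.commute)
  qed
  then have "card {..<N} \<le> card (\<Union>m\<in>?S. {m..<m + r})"
    by (intro card_mono) auto
  also have "\<dots> \<le> (\<Sum>m\<in>?S. card {m..<m + r})"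
    by (rule card_UN_le) simp
  finally show ?thesis by (simp add: mult.commute)
qed

section \<open>A run of the algorithm: measurability and pathwise bounds\<close>

locale ssdpm = prob_space M
  for M :: "'w measure" +
  fixes f :: "real^'n \<Rightarrow> real" and \<alpha> L :: real and r :: nat and x0 :: "real^'n"
    and x v :: "nat \<Rightarrow> 'w \<Rightarrow> real^'n" and Q :: "nat \<Rightarrow> 'w \<Rightarrow> real^'d^'n"
  assumes L_pos: "0 < L" and smooth: "L_smooth L f" and bdd: "bdd_below (range f)"
    and \<alpha>_pos: "0 < \<alpha>" and step_less: "\<alpha> * L < 1" and r_pos: "0 < r"
    and dim_less: "CARD('d) < CARD('n) - 1"
    and run: "ssdpm_run M f \<alpha> r x0 x v Q"
begin

definition g :: "nat \<Rightarrow> 'w \<Rightarrow> real^'n" where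
  "g k \<omega> = grad f (x k \<omega>)"

definition alignment :: "nat \<Rightarrow> 'w \<Rightarrow> real" where
  "alignment k \<omega> = (sgn (v k \<omega>) \<bullet> g k \<omega>)\<^sup>2"

text \<open>Almost surely this is the squared norm of P P^T g. The matrix Q Q^T stays visible
  because its entries are what the conditional law prescribes.\<close>

definition gain :: "nat \<Rightarrow> 'w \<Rightarrow> real" where
  "gain k \<omega> = alignment k \<omega> + g k \<omega> \<bullet> ((Q k \<omega> ** transpose (Q k \<omega>)) *v g k \<omega>)"

definition p :: real where
  "p = real CARD('d) / (real CARD('n) - 1)"

lemma p_bounds: "0 < p" "p < 1"
  using dim_less by (auto simp: p_def divide_simps)

lemma measurable_run [measurable]:
  "x k \<in> borel_measurable M" "v k \<in> borel_measurable M" "Q k \<in> borel_measurable M"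
  using run by (auto simp: ssdpm_run_def)

lemma measurable_grad: "grad f \<in> borel_measurable borel"
  using L_smooth_continuous_grad[OF _ smooth] L_pos by (intro borel_measurable_continuous_onI) auto

lemma measurable_f: "f \<in> borel_measurable borel"
  using smooth by (intro borel_measurable_continuous_onI differentiable_imp_continuous_on)
    (auto simp: L_smooth_def intro: differentiable_at_imp_differentiable_on)

lemma measurable_fx [measurable]: "(\<lambda>\<omega>. f (x k \<omega>)) \<in> borel_measurable M"
  by (rule measurable_compose[OF _ measurable_f]) simp

lemma measurable_g [measurable]: "g k \<in> borel_measurable M"
  unfolding g_def by (rule measurable_compose[OF _ measurable_grad]) simp

lemma measurable_alignment [measurable]: "alignment k \<in> borel_measurable M"
  unfolding alignment_def by measurable

lemma measurable_projection_entry [measurable]: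
  "(\<lambda>\<omega>. (Q k \<omega> ** transpose (Q k \<omega>)) $ i $ j) \<in> borel_measurable M"
  unfolding matrix_matrix_mult_def transpose_def by simp

lemma measurable_gain [measurable]: "gain k \<in> borel_measurable M"
  unfolding gain_def quadratic_form_eq_sum by simp

text \<open>With u = P P^T g and the step -\<alpha> u, both u \<bullet> g and |u|^2 equal the gain,
  so the linear and quadratic terms of the descent inequality merge into the factor \<alpha> (1 -
  \<alpha> L / 2).\<close>

lemma AE_step:
  "AE \<omega> in M. norm (x (Suc k) \<omega> - x k \<omega>) \<le> \<alpha> * norm (g k \<omega>) \<and>
     f (x (Suc k) \<omega>) \<le> f (x k \<omega>) - \<alpha> * (1 - \<alpha> * L / 2) * gain k \<omega> \<and>
     0 \<le> gain k \<omega> \<and> gain k \<omega> \<le> (norm (g k \<omega>))\<^sup>2 \<and>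
     (\<forall>i j. \<bar>(Q k \<omega> ** transpose (Q k \<omega>)) $ i $ j\<bar> \<le> 1)"
proof -
  have "AE \<omega> in M. v k \<omega> \<noteq> 0"
    and "AE \<omega> in M. (\<forall>j. column j (Q k \<omega>) \<bullet> v k \<omega> = 0) \<and> transpose (Q k \<omega>) ** Q k \<omega> = mat 1"
    using run by (auto simp: ssdpm_run_def)
  moreover have "AE \<omega> in M. \<omega> \<in> space M" by (rule AE_space)
  ultimately show ?thesis
  proof eventually_elim
    case (elim \<omega>)
    define u where "u = (subspace_matrix (v k \<omega>) (Q k \<omega>) **
      transpose (subspace_matrix (v k \<omega>) (Q k \<omega>))) *v g k \<omega>"
    have step: "x (Suc k) \<omega> = x k \<omega> - \<alpha> *\<^sub>R u"
      using run elim(3) by (simp add: ssdpm_run_def u_def g_def)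
    have uu: "u \<bullet> u = u \<bullet> g k \<omega>" and ug: "u \<bullet> g k \<omega> = gain k \<omega>"
      using subspace_projection_inner[of "v k \<omega>" "Q k \<omega>" "g k \<omega>"] elim
      by (simp_all add: u_def gain_def alignment_def)
    have le: "norm u \<le> norm (g k \<omega>)"
      using uu by (rule norm_le_if_inner_self_eq)
    have sq: "(norm u)\<^sup>2 = gain k \<omega>"
      using uu ug by (simp add: power2_norm_eq_inner)
    have "f (x (Suc k) \<omega>) \<le> f (x k \<omega>) - \<alpha> * gain k \<omega> + L / 2 * (\<alpha>\<^sup>2 * gain k \<omega>)"
      using L_smooth_descent[OF smooth, of "x k \<omega>" "- \<alpha> *\<^sub>R u"] ug sq
      by (simp add: step power_mult_distrib inner_commute[of _ u] flip: g_def)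
    then have "f (x (Suc k) \<omega>) \<le> f (x k \<omega>) - \<alpha> * (1 - \<alpha> * L / 2) * gain k \<omega>"
      by (simp add: algebra_simps power2_eq_square)
    moreover have "0 \<le> gain k \<omega>" "gain k \<omega> \<le> (norm (g k \<omega>))\<^sup>2"
      using sq le by (metis zero_le_power2, metis norm_ge_zero power_mono)
    ultimately show ?case
      using abs_orthonormal_projection_entry_le elim(2) le \<alpha>_pos by (auto simp: step)
  qed
qed

text \<open>A step of length at most \<alpha> |g| changes the gradient by at most \<alpha> L |g|.
  The upper factor yields deterministic bounds on all gradients, the lower one the strictness at the
  last iterate.\<close>

lemma AE_g_Suc:
  "AE \<omega> in M. (1 - \<alpha> * L) * norm (g k \<omega>) \<le> norm (g (Suc k) \<omega>) \<and>
     norm (g (Suc k) \<omega>) \<le> (1 + \<alpha> * L) * norm (g k \<omega>)"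
  using AE_step[of k]
proof eventually_elim
  case (elim \<omega>)
  have "norm (g (Suc k) \<omega> - g k \<omega>) \<le> L * norm (x (Suc k) \<omega> - x k \<omega>)"
    using smooth unfolding L_smooth_def g_def by blast
  also have "\<dots> \<le> L * (\<alpha> * norm (g k \<omega>))"
    using elim L_pos by (intro mult_left_mono) auto
  finally have "norm (g (Suc k) \<omega> - g k \<omega>) \<le> \<alpha> * L * norm (g k \<omega>)"
    by (simp add: mult_ac)
  then show ?case
    using norm_triangle_ineq2[of "g (Suc k) \<omega>" "g k \<omega>"]
      norm_triangle_ineq2[of "g k \<omega>" "g (Suc k) \<omega>"]
    by (simp add: algebra_simps norm_minus_commute)
qed

lemma x_0: "\<omega> \<in> space M \<Longrightarrow> x 0 \<omega> = x0"
  using run by (simp add: ssdpm_run_def)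

text \<open>Almost sure deterministic bounds make every expectation below finite.\<close>
lemma AE_g_bound: "AE \<omega> in M. norm (g k \<omega>) \<le> (1 + \<alpha> * L) ^ k * norm (grad f x0)"
proof (induction k)
  case 0
  show ?case by (rule AE_I2) (simp add: g_def x_0)
next
  case (Suc k)
  show ?case using Suc AE_g_Suc[of k]
  proof eventually_elim
    case (elim \<omega>)
    then show ?case
      using mult_left_mono[OF elim(1), of "1 + \<alpha> * L"] \<alpha>_pos L_pos by (simp add: mult_ac)
  qed
qed

lemma integrable_norm_g_power2 [simp]: "integrable M (\<lambda>\<omega>. (norm (g k \<omega>))\<^sup>2)"
proof (rule integrable_const_bound)
  show "AE \<omega> in M. norm ((norm (g k \<omega>))\<^sup>2) \<le> ((1 + \<alpha> * L) ^ k * norm (grad f x0))\<^sup>2"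
    using AE_g_bound[of k] by eventually_elim (simp add: power_mono)
qed simp

lemma alignment_bounds: "0 \<le> alignment k \<omega>" "alignment k \<omega> \<le> (norm (g k \<omega>))\<^sup>2"
proof -
  have "\<bar>sgn (v k \<omega>) \<bullet> g k \<omega>\<bar> \<le> norm (sgn (v k \<omega>)) * norm (g k \<omega>)"
    by (rule Cauchy_Schwarz_ineq2)
  also have "\<dots> \<le> norm (g k \<omega>)"
    by (simp add: norm_sgn)
  finally show "alignment k \<omega> \<le> (norm (g k \<omega>))\<^sup>2"
    unfolding alignment_def by (metis abs_ge_zero power2_abs power_mono)
qed (simp add: alignment_def)

lemma integrable_alignment [simp]: "integrable M (alignment k)"
  by (rule Bochner_Integration.integrable_bound[OF integrable_norm_g_power2[of k]])
    (auto simp: alignment_bounds)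

lemma integrable_gain [simp]: "integrable M (gain k)"
proof (rule Bochner_Integration.integrable_bound[OF integrable_norm_g_power2[of k]])
  show "AE \<omega> in M. norm (gain k \<omega>) \<le> norm ((norm (g k \<omega>))\<^sup>2)"
    using AE_step[of k] by eventually_elim simp
qed simp

text \<open>The gain is nonnegative, so \<open>f\<close> never increases along the run; together
  with the lower bound on \<open>f\<close> this makes \<open>f (x k)\<close> bounded and hence
  integrable.\<close>

lemma AE_f_le: "AE \<omega> in M. f (x k \<omega>) \<le> f x0"
proof (induction k)
  case 0
  show ?case by (rule AE_I2) (simp add: x_0)
next
  case (Suc k)
  show ?case using Suc AE_step[of k]
  proof eventually_elim
    case (elim \<omega>)
    have "0 \<le> \<alpha> * (1 - \<alpha> * L / 2) * gain k \<omega>"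
      using elim \<alpha>_pos step_less by (intro mult_nonneg_nonneg) auto
    then show ?case using elim by linarith
  qed
qed

lemma integrable_fx [simp]: "integrable M (\<lambda>\<omega>. f (x k \<omega>))"
proof (rule integrable_const_bound)
  show "AE \<omega> in M. norm (f (x k \<omega>)) \<le> max \<bar>f x0\<bar> \<bar>INF y. f y\<bar>"
    using AE_f_le[of k]
  proof eventually_elim
    case (elim \<omega>)
    have "(INF y. f y) \<le> f (x k \<omega>)"
      using bdd by (intro cINF_lower) auto
    then show ?case using elim by auto
  qed
qed simp

section \<open>Telescoped expected decrease and the gap left at the end\<close>

lemma sum_expectation_gain_le:
  "\<alpha> * (1 - \<alpha> * L / 2) * (\<Sum>k<N. expectation (gain k)) \<le> f x0 - expectation (\<lambda>\<omega>. f (x N \<omega>))"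
proof (induction N)
  case 0
  have "expectation (\<lambda>\<omega>. f (x 0 \<omega>)) = expectation (\<lambda>\<omega>. f x0)"
    by (rule Bochner_Integration.integral_cong) (auto simp: x_0)
  then show ?case by (simp add: prob_space)
next
  case (Suc N)
  have "expectation (\<lambda>\<omega>. f (x (Suc N) \<omega>)) \<le>
      expectation (\<lambda>\<omega>. f (x N \<omega>) - \<alpha> * (1 - \<alpha> * L / 2) * gain N \<omega>)"
  proof (rule integral_mono_AE)
    show "AE \<omega> in M. f (x (Suc N) \<omega>) \<le> f (x N \<omega>) - \<alpha> * (1 - \<alpha> * L / 2) * gain N \<omega>"
      using AE_step[of N] by eventually_elim simp
  qed (auto intro!: Bochner_Integration.integrable_diff)
  also have "\<dots> = expectation (\<lambda>\<omega>. f (x N \<omega>)) - \<alpha> * (1 - \<alpha> * L / 2) * expectation (gain N)"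
    by (simp add: Bochner_Integration.integral_diff)
  finally show ?case using Suc by (simp add: distrib_left)
qed

text \<open>Transfers largeness of the gradient at index k to a positive gap at index k + 1. This is
  what the iterate \<open>x N\<close> requires when gradients are controlled only at indices below
  \<open>N\<close>.\<close>

lemma expectation_gap_Suc:
  "(1 - \<alpha> * L)\<^sup>2 * expectation (\<lambda>\<omega>. (norm (g k \<omega>))\<^sup>2) / (2 * L)
     \<le> expectation (\<lambda>\<omega>. f (x (Suc k) \<omega>)) - (INF y. f y)"
proof -
  have "expectation (\<lambda>\<omega>. (1 - \<alpha> * L)\<^sup>2 / (2 * L) * (norm (g k \<omega>))\<^sup>2)
      \<le> expectation (\<lambda>\<omega>. f (x (Suc k) \<omega>) - (INF y. f y))"
  proof (rule integral_mono_AE)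
    show "AE \<omega> in M. (1 - \<alpha> * L)\<^sup>2 / (2 * L) * (norm (g k \<omega>))\<^sup>2 \<le> f (x (Suc k) \<omega>) - (INF y. f y)"
      using AE_g_Suc[of k]
    proof eventually_elim
      case (elim \<omega>)
      have "((1 - \<alpha> * L) * norm (g k \<omega>))\<^sup>2 / (2 * L) \<le> (norm (g (Suc k) \<omega>))\<^sup>2 / (2 * L)"
        using elim step_less L_pos by (intro divide_right_mono power_mono) auto
      also have "\<dots> \<le> f (x (Suc k) \<omega>) - (INF y. f y)"
        unfolding g_def by (rule L_smooth_gap[OF L_pos smooth bdd])
      finally show ?case by (simp add: power_mult_distrib)
    qed
  qed (auto intro!: Bochner_Integration.integrable_diff)
  then show ?thesis
    by (simp add: Bochner_Integration.integral_diff prob_space)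
qed

section \<open>The history and the expected gain of a step\<close>

lemma sets_history:
  defines "G k \<equiv> (\<Union>i\<le>k. sets (vimage_algebra (space M) (x i) borel)) \<union>
      (\<Union>i\<le>k. sets (vimage_algebra (space M) (v i) borel)) \<union>
      (\<Union>i<k. sets (vimage_algebra (space M) (Q i) borel))"
  shows "G k \<subseteq> events" and "sets (ssdpm_history M x v Q k) = sigma_sets (space M) (G k)"
proof -
  have *: "sets (vimage_algebra (space M) W borel) \<subseteq> events" if "W \<in> borel_measurable M"
    for W :: "'w \<Rightarrow> 'b::topological_space"
    using that by (simp add: measurable_iff_sets)
  show sub: "G k \<subseteq> events"
    unfolding G_def by (intro Un_least UN_least * measurable_run)
  show "sets (ssdpm_history M x v Q k) = sigma_sets (space M) (G k)"
    unfolding ssdpm_history_def G_def[symmetric]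
    by (rule sets_measure_of[OF order_trans[OF sub sets.space_closed]])
qed

lemma space_history: "space (ssdpm_history M x v Q k) = space M"
  by (simp add: ssdpm_history_def space_measure_of_conv)

lemma subalgebra_history: "subalgebra M (ssdpm_history M x v Q k)"
  unfolding subalgebra_def space_history sets_history(2)
  using sets.sigma_sets_subset[OF sets_history(1)] by blast

lemma measurable_x_history: "x k \<in> borel_measurable (ssdpm_history M x v Q k)"
  unfolding measurable_iff_sets space_history sets_history(2) by (auto intro: sigma_sets.Basic)

lemma measurable_g_history: "g k \<in> borel_measurable (ssdpm_history M x v Q k)"
  unfolding g_def by (rule measurable_compose[OF measurable_x_history measurable_grad])

text \<open>The gradient is measurable with respect to the history, so under the expectation Q Q^T
  may be replaced by its conditional mean \<open>C\<close>, which is p times the projection onto the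
  complement of \<open>v\<close>. Its quadratic form at g is p (|g|^2 - alignment).\<close>

lemma expectation_gain:
  "expectation (gain k) = p * expectation (\<lambda>\<omega>. (norm (g k \<omega>))\<^sup>2) + (1 - p) * expectation (alignment k)"
proof -
  let ?A = "\<lambda>\<omega>. Q k \<omega> ** transpose (Q k \<omega>)"
  define C :: "'w \<Rightarrow> real^'n^'n" where
    "C \<omega> = (\<chi> i j. p * ((mat 1 :: real^'n^'n) $ i $ j - sgn (v k \<omega>) $ i * sgn (v k \<omega>) $ j))" for \<omega>
  have "AE \<omega> in M. real_cond_exp M (ssdpm_history M x v Q k) (\<lambda>\<omega>. ?A \<omega> $ i $ j) \<omega> = C \<omega> $ i $ j" for i j
    using run by (simp add: ssdpm_run_def C_def p_def)
  moreover have "AE \<omega> in M. \<bar>?A \<omega> $ i $ j\<bar> \<le> 1" for i j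
    using AE_step[of k] by eventually_elim simp
  ultimately have eq: "expectation (\<lambda>\<omega>. g k \<omega> \<bullet> (?A \<omega> *v g k \<omega>)) =
      expectation (\<lambda>\<omega>. g k \<omega> \<bullet> (C \<omega> *v g k \<omega>))"
    by (intro expectation_quadratic_form_cond_exp[OF subalgebra_history measurable_g_history _ _ _ AE_g_bound])
      (auto simp: C_def)
  have C: "g k \<omega> \<bullet> (C \<omega> *v g k \<omega>) = p * ((norm (g k \<omega>))\<^sup>2 - alignment k \<omega>)" for \<omega>
  proof -
    have "C \<omega> *v w = p *\<^sub>R (w - (sgn (v k \<omega>) \<bullet> w) *\<^sub>R sgn (v k \<omega>))" for w
    proof -
      have id: "(\<Sum>j\<in>UNIV. (mat 1 :: real^'n^'n) $ i $ j * w $ j) = w $ i" for i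
        using matrix_vector_mul_lid[of w] by (simp add: vec_eq_iff matrix_vector_mult_def)
      have "(C \<omega> *v w) $ i = p * (w $ i - (sgn (v k \<omega>) \<bullet> w) * sgn (v k \<omega>) $ i)" for i
      proof -
        have "(C \<omega> *v w) $ i = (\<Sum>j\<in>UNIV. p * ((mat 1 :: real^'n^'n) $ i $ j * w $ j) -
            p * (sgn (v k \<omega>) $ i * (sgn (v k \<omega>) $ j * w $ j)))"
          by (simp add: C_def matrix_vector_mult_def algebra_simps)
        also have "\<dots> = p * w $ i - p * (sgn (v k \<omega>) $ i * (sgn (v k \<omega>) \<bullet> w))"
          by (simp only: sum_subtractf sum_distrib_left[symmetric] id inner_vec_def inner_real_def)
        finally show ?thesis by (simp add: algebra_simps)
      qed
      then show ?thesis
        by (simp add: vec_eq_iff)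
    qed
    then show ?thesis
      unfolding power2_norm_eq_inner alignment_def
      by (simp add: inner_diff_right power2_eq_square inner_commute)
  qed
  \<comment> \<open>The quadratic form is the gain minus the alignment, both integrable.\<close>
  have int: "integrable M (\<lambda>\<omega>. g k \<omega> \<bullet> (?A \<omega> *v g k \<omega>))"
    using Bochner_Integration.integrable_diff[OF integrable_gain[of k] integrable_alignment[of k]]
    by (simp add: gain_def)
  have "expectation (gain k) =
      expectation (alignment k) + expectation (\<lambda>\<omega>. g k \<omega> \<bullet> (?A \<omega> *v g k \<omega>))"
    unfolding gain_def using int by (simp add: Bochner_Integration.integral_add)
  also have "\<dots> = expectation (alignment k)
      + p * (expectation (\<lambda>\<omega>. (norm (g k \<omega>))\<^sup>2) - expectation (alignment k))"
    by (simp add: eq C Bochner_Integration.integral_diff)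
  finally show ?thesis by (simp add: algebra_simps)
qed

text \<open>Integrate the conditional bound given \<open>x k\<close>; conditional expectation
  preserves the mean.\<close>

lemma expectation_alignment_ge:
  assumes "AE \<omega> in M. real_cond_exp M (vimage_algebra (space M) (x k) borel) (alignment k) \<omega>
      \<ge> \<gamma>0 * (norm (g k \<omega>))\<^sup>2"
  shows "\<gamma>0 * expectation (\<lambda>\<omega>. (norm (g k \<omega>))\<^sup>2) \<le> expectation (alignment k)"
proof -
  have "subalgebra M (vimage_algebra (space M) (x k) borel)"
    using measurable_run(1)[of k] by (simp add: subalgebra_def measurable_iff_sets)
  then interpret sigma_finite_subalgebra M "vimage_algebra (space M) (x k) borel"
    by (rule sigma_finite_subalgebraI)
  have "expectation (\<lambda>\<omega>. \<gamma>0 * (norm (g k \<omega>))\<^sup>2)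
      \<le> expectation (real_cond_exp M (vimage_algebra (space M) (x k) borel) (alignment k))"
    using assms by (intro integral_mono_AE real_cond_exp_int) auto
  then show ?thesis
    by (simp add: real_cond_exp_int)
qed

text \<open>The contrapositive form of the iteration count: persistently large gradients force a
  total expected decrease that must still fit strictly below the initial gap.\<close>

lemma iteration_bound:
  assumes refresh: "\<And>k. r dvd k \<Longrightarrow>
      AE \<omega> in M. real_cond_exp M (vimage_algebra (space M) (x k) borel) (alignment k) \<omega>
        \<ge> \<gamma>0 * (norm (g k \<omega>))\<^sup>2"
    and "0 \<le> \<gamma>0" "0 < \<epsilon>" "0 < N"
    and large: "\<And>k. k < N \<Longrightarrow> \<epsilon>\<^sup>2 \<le> expectation (\<lambda>\<omega>. (norm (g k \<omega>))\<^sup>2)"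
  shows "\<alpha> * (1 - \<alpha> * L / 2) * (real N * (p + (1 - p) * \<gamma>0 / real r)) * \<epsilon>\<^sup>2 < f x0 - (INF y. f y)"
proof -
  let ?E = "\<lambda>k. expectation (\<lambda>\<omega>. (norm (g k \<omega>))\<^sup>2)"
  let ?S = "{k. k < N \<and> r dvd k}"
  \<comment> \<open>Refresh steps carry the extra weight (1 - p) \<gamma>0; at the other steps the
    alignment is bounded below by 0.\<close>
  have "(p + (if r dvd k then (1 - p) * \<gamma>0 else 0)) * \<epsilon>\<^sup>2 \<le> expectation (gain k)" if "k < N" for k
  proof -
    have "0 \<le> expectation (alignment k)"
      by (simp add: alignment_bounds)
    then have "(if r dvd k then \<gamma>0 else 0) * ?E k \<le> expectation (alignment k)"
      using expectation_alignment_ge[OF refresh] by simp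
    then have "p * ?E k + (1 - p) * ((if r dvd k then \<gamma>0 else 0) * ?E k) \<le> expectation (gain k)"
      unfolding expectation_gain using p_bounds by (intro add_left_mono mult_left_mono) auto
    moreover have "(p + (if r dvd k then (1 - p) * \<gamma>0 else 0)) * \<epsilon>\<^sup>2
        \<le> (p + (if r dvd k then (1 - p) * \<gamma>0 else 0)) * ?E k"
      using p_bounds \<open>0 \<le> \<gamma>0\<close> by (intro mult_left_mono large that) auto
    ultimately show ?thesis
      by (auto simp: algebra_simps split: if_splits)
  qed
  then have "(\<Sum>k<N. (p + (if r dvd k then (1 - p) * \<gamma>0 else 0)) * \<epsilon>\<^sup>2) \<le> (\<Sum>k<N. expectation (gain k))"
    by (intro sum_mono) auto
  also have "(\<Sum>k<N. (p + (if r dvd k then (1 - p) * \<gamma>0 else 0)) * \<epsilon>\<^sup>2)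
      = (real N * p + (\<Sum>k<N. if r dvd k then (1 - p) * \<gamma>0 else 0)) * \<epsilon>\<^sup>2"
    by (simp add: sum.distrib flip: sum_distrib_right)
  also have "(\<Sum>k<N. if r dvd k then (1 - p) * \<gamma>0 else 0) = real (card ?S) * ((1 - p) * \<gamma>0)"
    by (simp add: sum.If_cases Collect_conj_eq lessThan_def)
  finally have sum: "(real N * p + real (card ?S) * ((1 - p) * \<gamma>0)) * \<epsilon>\<^sup>2 \<le> (\<Sum>k<N. expectation (gain k))" .
  have "real N \<le> real r * real (card ?S)"
    using card_multiples_below[OF r_pos, of N] by (metis of_nat_le_iff of_nat_mult)
  then have "real N / real r \<le> real (card ?S)"
    using r_pos by (simp add: field_simps)
  then have "(real N / real r) * ((1 - p) * \<gamma>0) \<le> real (card ?S) * ((1 - p) * \<gamma>0)"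
    using p_bounds \<open>0 \<le> \<gamma>0\<close> by (intro mult_right_mono) auto
  then have "real N * (p + (1 - p) * \<gamma>0 / real r) \<le> real N * p + real (card ?S) * ((1 - p) * \<gamma>0)"
    by (simp add: distrib_left)
  then have "real N * (p + (1 - p) * \<gamma>0 / real r) * \<epsilon>\<^sup>2 \<le> (\<Sum>k<N. expectation (gain k))"
    using sum by (meson mult_right_mono order_trans zero_le_power2)
  then have "\<alpha> * (1 - \<alpha> * L / 2) * (real N * (p + (1 - p) * \<gamma>0 / real r) * \<epsilon>\<^sup>2)
      \<le> \<alpha> * (1 - \<alpha> * L / 2) * (\<Sum>k<N. expectation (gain k))"
    using \<alpha>_pos step_less by (intro mult_left_mono) auto
  also have "\<dots> \<le> f x0 - expectation (\<lambda>\<omega>. f (x N \<omega>))"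
    by (rule sum_expectation_gain_le)
  also have "\<dots> < f x0 - (INF y. f y)"
  proof -
    \<comment> \<open>The last controlled gradient has index N - 1; its positive mean square keeps E
      f(x N) strictly above the infimum.\<close>
    obtain k where N: "N = Suc k"
      using \<open>0 < N\<close> gr0_implies_Suc by blast
    have "0 < ?E k"
      using large[of k] N \<open>0 < \<epsilon>\<close> by (auto intro: less_le_trans[of 0 "\<epsilon>\<^sup>2"])
    then have "0 < (1 - \<alpha> * L)\<^sup>2 * ?E k / (2 * L)"
      using L_pos step_less by simp
    then show ?thesis
      using expectation_gap_Suc[of k] N by simp
  qed
  finally show ?thesis
    by (simp add: mult_ac)
qed

end

section \<open>From the stated constants to the iteration count\<close>

theorem theorem1:
  fixes M :: "'w measure"
    and f :: "real^'n \<Rightarrow> real"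
    and x0 :: "real^'n"
    and x v :: "nat \<Rightarrow> 'w \<Rightarrow> real^'n"
    and Q :: "nat \<Rightarrow> 'w \<Rightarrow> real^'d^'n"
    and L \<alpha> \<delta> \<delta>t \<gamma>0 f_opt t0 t0t K :: real
    and r n d :: nat
  assumes "prob_space M"
    and n_eq: "n = CARD('n)" and d_eq: "d = CARD('d)" and d_less: "d < n - 1"
    and L_pos: "0 < L" and smooth: "L_smooth L f"
    and bdd: "bdd_below (range f)" and f_opt_eq: "f_opt = (INF y. f y)"
    and \<alpha>_pos: "0 < \<alpha>"
    and \<delta>t_eq: "\<delta>t = \<delta> + sqrt (real d / (real n - 1))" and \<delta>t_pos: "0 < \<delta>t"
    and \<gamma>0_gt: "\<delta>t < \<gamma>0"
    and r_pos: "0 < r"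
    and r_eq: "real r = (1 - 2 * \<alpha> * L) / (4 * \<alpha> * L * (1 - \<alpha> * L)) * ln (\<gamma>0 / \<delta>t)"
    and run: "ssdpm_run M f \<alpha> r x0 x v Q"
    and refresh: "\<And>k. r dvd k \<Longrightarrow> AE \<omega> in M.
          real_cond_exp M (vimage_algebra (space M) (x k) borel)
            (\<lambda>\<omega>. (sgn (v k \<omega>) \<bullet> grad f (x k \<omega>))\<^sup>2) \<omega>
          \<ge> \<gamma>0 * (norm (grad f (x k \<omega>)))\<^sup>2"
    and t0_eq: "t0 = ssdpm_t0 \<alpha> L n d"
    and t0t_eq: "t0t = t0 * (1 - real d / (real n - 1)) * sqrt (real d / (real n - 1)) *
          (1 - 4 * \<alpha> * L * (1 - \<alpha> * L) / ((1 - 2 * \<alpha> * L) * ln (\<gamma>0 / \<delta>t)))"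
    and K_eq: "K = ln (\<gamma>0 / \<delta>t) *
          ((t0 * (1 - real d / (real n - 1)) * sqrt (real d / (real n - 1)) - real d / (real n - 1)) /
           ((1 - real d / (real n - 1)) * (\<gamma>0 + t0 * sqrt (real d / (real n - 1)))))"
    and \<alpha>_lower: "1 / L * (K / (2 + K + sqrt (4 + K\<^sup>2))) < \<alpha>"
    and \<alpha>_upper: "\<alpha> < 1 / (2 * L)"
  shows "(\<exists>C. \<forall>\<alpha> L n d. 0 < \<alpha> \<longrightarrow> 0 < L \<longrightarrow> \<alpha> < 1 / (2 * L) \<longrightarrow> 0 < d \<longrightarrow> d < n - 1 \<longrightarrow>
           4 / 9 < ssdpm_t0 \<alpha> L n d \<and> ssdpm_t0 \<alpha> L n d < 1 / 2 + C * (real d / real n)) \<and>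
         (\<forall>\<epsilon>>0. \<forall>N>0.
           real N \<ge> (1 / \<alpha>) * (1 / (1 - \<alpha> * L / 2)) * (f x0 - f_opt) /
             (4 * \<alpha> * L * (1 - \<alpha> * L) / ((1 - 2 * \<alpha> * L) * ln (\<gamma>0 / \<delta>t)) *
                (1 - real d / (real n - 1)) * \<gamma>0 + real d / (real n - 1) - t0t) * (1 / \<epsilon>\<^sup>2)
           \<longrightarrow> (MIN i\<in>{..<N}. prob_space.expectation M (\<lambda>\<omega>. (norm (grad f (x i \<omega>)))\<^sup>2)) < \<epsilon>\<^sup>2)"
proof -
  define a where "a = \<alpha> * L"
  define p where "p = real d / (real n - 1)"
  define l where "l = ln (\<gamma>0 / \<delta>t)"
  define D where "D = (1 - p) * \<gamma>0 / real r + p - t0t"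
  have a: "0 < a" "a < 1 / 2"
    using \<alpha>_pos L_pos \<alpha>_upper by (simp_all add: a_def field_simps)
  have n: "real d < real n - 1" "0 < d"
    using d_less by (auto simp: d_eq)
  have p: "0 < p" "p < 1"
    using n by (simp_all add: p_def)
  have l: "0 < l"
    using \<delta>t_pos \<gamma>0_gt by (simp add: l_def)
  have \<gamma>0: "0 < \<gamma>0"
    using \<delta>t_pos \<gamma>0_gt by simp
  \<comment> \<open>The formula for the refresh period, inverted; it turns the denominator of the
    claim into \<open>D\<close>.\<close>
  have rate: "4 * a * (1 - a) / ((1 - 2 * a) * l) = 1 / real r"
  proof -
    have "real r = (1 - 2 * a) / (4 * a * (1 - a)) * l"
      using r_eq by (simp add: a_def l_def mult.assoc)
    then show ?thesis by simp
  qed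
  have t0: "0 < t0"
    using ssdpm_t0_bounds(1)[OF \<alpha>_pos L_pos \<alpha>_upper n(2) d_less] by (simp add: t0_eq)
  have t0t: "t0t = t0 * (1 - p) * sqrt p * (1 - 1 / real r)"
    using t0t_eq rate by (simp add: a_def p_def l_def mult.assoc)
  \<comment> \<open>The factor 1 - 1/r is nonnegative because \<open>r\<close> is a positive
    integer.\<close>
  have t0t_nonneg: "0 \<le> t0t"
    unfolding t0t using t0 p r_pos by (intro mult_nonneg_nonneg) auto
  have denominator: "4 * \<alpha> * L * (1 - \<alpha> * L) / ((1 - 2 * \<alpha> * L) * ln (\<gamma>0 / \<delta>t)) *
      (1 - real d / (real n - 1)) * \<gamma>0 + real d / (real n - 1) - t0t = D"
    using rate by (simp add: D_def a_def p_def l_def mult.assoc)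
  have D_pos: "0 < D"
  proof -
    have "K / (2 + K + sqrt (4 + K\<^sup>2)) < a"
      using mult_strict_left_mono[OF \<alpha>_lower L_pos] L_pos by (simp add: a_def mult.commute)
    then have "K < 4 * a * (1 - a) / (1 - 2 * a)"
      by (rule step_size_quadratic_gt[OF a(2)])
    also have "\<dots> = l * (1 / real r)"
      using l a by (simp flip: rate)
    finally have "l * ((t0 * (1 - p) * sqrt p - p) / ((1 - p) * (\<gamma>0 + t0 * sqrt p))) < l * (1 / real r)"
      unfolding K_eq p_def l_def .
    then have "(t0 * (1 - p) * sqrt p - p) / ((1 - p) * (\<gamma>0 + t0 * sqrt p)) < 1 / real r"
      by (simp only: mult_less_cancel_left_pos[OF l])
    moreover have "0 < (1 - p) * (\<gamma>0 + t0 * sqrt p)"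
      using p \<gamma>0 t0 by (simp add: add_pos_pos)
    \<comment> \<open>Moving the term with t0 / r to the left turns this inequality into D >
      0.\<close>
    ultimately have "t0 * (1 - p) * sqrt p - p < 1 / real r * ((1 - p) * (\<gamma>0 + t0 * sqrt p))"
      by (simp only: pos_divide_less_eq)
    then show ?thesis
      by (simp add: D_def t0t algebra_simps add_divide_distrib diff_divide_distrib)
  qed
  \<comment> \<open>The explicit factor 1 is the witness for the constant \<open>C\<close>.\<close>
  have "ssdpm_t0 \<alpha>' L' n' d' < 1 / 2 + 1 * (real d' / real n') \<and> 4 / 9 < ssdpm_t0 \<alpha>' L' n' d'"
    if "0 < \<alpha>'" "0 < L'" "\<alpha>' < 1 / (2 * L')" "0 < d'" "d' < n' - 1" for \<alpha>' L' n' d'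
    using ssdpm_t0_bounds[OF that] by simp
  then have t0_range: "\<exists>C. \<forall>\<alpha> L n d. 0 < \<alpha> \<longrightarrow> 0 < L \<longrightarrow> \<alpha> < 1 / (2 * L) \<longrightarrow> 0 < d \<longrightarrow> d < n - 1 \<longrightarrow>
      4 / 9 < ssdpm_t0 \<alpha> L n d \<and> ssdpm_t0 \<alpha> L n d < 1 / 2 + C * (real d / real n)"
    by blast
  interpret prob_space M by fact
  interpret run: ssdpm M f \<alpha> L r x0 x v Q
    using assms(5,6,7,9,13) a run d_less
    by unfold_locales (auto simp: a_def n_eq d_eq)
  have p_eq: "run.p = p"
    by (simp add: run.p_def p_def n_eq d_eq)
  have alignment: "run.alignment k = (\<lambda>\<omega>. (sgn (v k \<omega>) \<bullet> grad f (x k \<omega>))\<^sup>2)" for k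
    by (simp add: fun_eq_iff run.alignment_def run.g_def)
  have "(MIN i\<in>{..<N}. expectation (\<lambda>\<omega>. (norm (grad f (x i \<omega>)))\<^sup>2)) < \<epsilon>\<^sup>2"
    if "0 < \<epsilon>" "0 < N"
      and N: "(1 / \<alpha>) * (1 / (1 - \<alpha> * L / 2)) * (f x0 - f_opt) / D * (1 / \<epsilon>\<^sup>2) \<le> real N" for \<epsilon> N
  proof (rule ccontr)
    assume "\<not> ?thesis"
    then have large: "\<epsilon>\<^sup>2 \<le> expectation (\<lambda>\<omega>. (norm (run.g i \<omega>))\<^sup>2)" if "i < N" for i
      using that \<open>0 < N\<close> by (auto simp: not_less Min_ge_iff run.g_def lessThan_empty_iff)
    have "\<alpha> * (1 - \<alpha> * L / 2) * (real N * (p + (1 - p) * \<gamma>0 / real r)) * \<epsilon>\<^sup>2 < f x0 - f_opt"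
      using run.iteration_bound[of \<gamma>0 \<epsilon> N] refresh \<gamma>0 that(1,2) large
      by (simp add: alignment p_eq f_opt_eq run.g_def)
    \<comment> \<open>\<open>D\<close> is the guaranteed gain per step minus the nonnegative
      \<open>t0t\<close>.\<close>
    moreover have "\<alpha> * (1 - \<alpha> * L / 2) * (real N * D) * \<epsilon>\<^sup>2
        \<le> \<alpha> * (1 - \<alpha> * L / 2) * (real N * (p + (1 - p) * \<gamma>0 / real r)) * \<epsilon>\<^sup>2"
      using \<alpha>_pos a t0t_nonneg
      by (intro mult_left_mono mult_right_mono) (auto simp: D_def a_def)
    \<comment> \<open>The assumed bound on \<open>N\<close>, rearranged; dividing by
      \<open>D\<close> is legitimate because D > 0.\<close>
    moreover have "f x0 - f_opt \<le> \<alpha> * (1 - \<alpha> * L / 2) * (real N * D) * \<epsilon>\<^sup>2"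
    proof -
      have "0 < 1 - \<alpha> * L / 2"
        using a by (simp add: a_def)
      then show ?thesis
        using N \<alpha>_pos D_pos \<open>0 < \<epsilon>\<close> by (simp add: divide_le_eq mult_ac)
    qed
    ultimately show False by linarith
  qed
  then show ?thesis
    using t0_range unfolding denominator by blast
qed

end
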